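(* The set of elementary functions $\mathcal{E}$ equals the set of functions with values in $\mathbb{N}$ (i.e. of the form $\mathbb{N}^p\to\mathbb{N}$) belonging to the smallest class of functions that contains the zero function $\mathbf{0}$, the projections $\pi^p_i$, the successor $s$, addition $+$ and subtraction $-$ (on $\mathbb{Z}$), and that is closed under composition and the discrete linear ODE scheme $\mathrm{LI}$. The same holds if the (vectorial) linear ODE scheme is replaced by the scalar discrete linear ODE scheme.
   Context: The class $\mathcal{E}$ of elementary functions is the smallest class of functions $\mathbb{N}^p\to\mathbb{N}$ containing $\mathbf 0$, the projections, the successor $s(n)=n+1$, addition, truncated subtraction $(n_1,n_2)\mapsto\max(0,n_1-n_2)$, and closed under composition, bounded sum $(x,\mathbf y)\mapsto\sum_{z\le x}g(z,\mathbf y)$ and bounded product $(x,\mathbf y)\mapsto\prod_{z\le x}g(z,\mathbf y)$. Discrete derivative: $\frac{\delta f(x,\mathbf y)}{\delta x}=f(x+1,\mathbf y)-f(x,\mathbf y)$. Linear ODE scheme $\mathrm{LI}$: given $\mathbf G=(g_i)_{1\le i\le k}$ with $g_i:\mathbb{N}^p\to\mathbb{N}$, a $k\times k$ matrix $\mathbf A=(a_{i,j})$ and a vector $\mathbf B=(b_i)$ with $a_{i,j},b_i:\mathbb{N}^{p+1}\to\mathbb{Z}$, $\mathbf f=\mathrm{LI}(\mathbf G,\mathbf A,\mathbf B):\mathbb{N}^{p+1}\to\mathbb{Z}^k$ is the unique solution of $\frac{\delta \mathbf f(x,\mathbf y)}{\delta x}=\mathbf A(x,\mathbf y)\cdot\mathbf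 f(x,\mathbf y)+\mathbf B(x,\mathbf y)$, $\mathbf f(0,\mathbf y)=\mathbf G(\mathbf y)$. The scalar scheme is the case $k=1$. *)

theory Defs
  imports Complex_Main "HOL-Library.FuncSet"
begin

text \<open>
  Tuples are lists of fixed length. A function with domain \<open>D\<close> is an extensional function on
  \<open>D\<close> (\<open>undefined\<close> outside), so that equality is equality of functions with domain \<open>D\<close>;
  arities and domains are kept in the first component of a pair.
\<close>

definition natvec :: "nat \<Rightarrow> nat list set" where
  "natvec p = {v. length v = p}"

inductive_set elementary :: "(nat \<times> (nat list \<Rightarrow> nat)) set" where
  zero: "(p, \<lambda>v\<in>natvec p. 0) \<in> elementary"
| proj: "i < p \<Longrightarrow> (p, \<lambda>v\<in>natvec p. v ! i) \<in> elementary"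
| succ: "(1, \<lambda>v\<in>natvec 1. v ! 0 + 1) \<in> elementary"
| add: "(2, \<lambda>v\<in>natvec 2. v ! 0 + v ! 1) \<in> elementary"
| monus: "(2, \<lambda>v\<in>natvec 2. v ! 0 - v ! 1) \<in> elementary"
| comp: "(length gs, h) \<in> elementary \<Longrightarrow> (\<And>g. g \<in> set gs \<Longrightarrow> (p, g) \<in> elementary) \<Longrightarrow>
    (p, \<lambda>v\<in>natvec p. h (map (\<lambda>g. g v) gs)) \<in> elementary"
| bsum: "(Suc p, g) \<in> elementary \<Longrightarrow>
    (Suc p, \<lambda>v\<in>natvec (Suc p). \<Sum>z\<le>hd v. g (z # tl v)) \<in> elementary"
| bprod: "(Suc p, g) \<in> elementary \<Longrightarrow>
    (Suc p, \<lambda>v\<in>natvec (Suc p). \<Prod>z\<le>hd v. g (z # tl v)) \<in> elementary"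

text \<open>The domains \<open>\<nat>\<^sup>p\<close> and \<open>\<int>\<^sup>p\<close>, both as sets of integer tuples.\<close>

definition Nvec :: "nat \<Rightarrow> int list set" where
  "Nvec p = {v. length v = p \<and> (\<forall>x\<in>set v. 0 \<le> x)}"

definition Zvec :: "nat \<Rightarrow> int list set" where
  "Zvec p = {v. length v = p}"

definition delta :: "(int \<Rightarrow> int) \<Rightarrow> int \<Rightarrow> int" where
  "delta F x = F (x + 1) - F x"

definition is_LI ::
  "nat \<Rightarrow> nat \<Rightarrow> (nat \<Rightarrow> int list \<Rightarrow> int) \<Rightarrow> (nat \<Rightarrow> nat \<Rightarrow> int list \<Rightarrow> int) \<Rightarrow>
   (nat \<Rightarrow> int list \<Rightarrow> int) \<Rightarrow> (int list \<Rightarrow> int list) \<Rightarrow> bool" where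
  "is_LI k p G A B f \<longleftrightarrow>
     f \<in> Nvec (Suc p) \<rightarrow>\<^sub>E Zvec k \<and>
     (\<forall>y\<in>Nvec p. \<forall>i<k. f (0 # y) ! i = G i y) \<and>
     (\<forall>y\<in>Nvec p. \<forall>x\<ge>0. \<forall>i<k.
        delta (\<lambda>t. f (t # y) ! i) x
          = (\<Sum>j<k. A i j (x # y) * f (x # y) ! j) + B i (x # y))"

lemma is_LI_unique_solution: "\<exists>!f. is_LI k p G A B f"
proof -
  define step where "step y x w = map (\<lambda>i. w ! i + (\<Sum>j<k. A i j (int x # y) * w ! j)
      + B i (int x # y)) [0..<k]" for y x and w :: "int list"
  define F where "F y n = rec_nat (map (\<lambda>i. G i y) [0..<k]) (step y) n" for y n
  have F0: "F y 0 = map (\<lambda>i. G i y) [0..<k]" and FS: "F y (Suc n) = step y n (F y n)" for y n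
    by (simp_all add: F_def)
  have lenF: "length (F y n) = k" for y n
    by (cases n) (simp_all add: F0 FS step_def)
  define f where "f = (\<lambda>v\<in>Nvec (Suc p). F (tl v) (nat (hd v)))"
  have f_app: "f (x # y) = F y (nat x)" if "y \<in> Nvec p" "x \<ge> 0" for x y
    using that by (simp add: f_def Nvec_def)
  have "is_LI k p G A B f"
    unfolding is_LI_def delta_def
  proof (intro conjI ballI allI impI)
    show "f \<in> Nvec (Suc p) \<rightarrow>\<^sub>E Zvec k"
      by (auto simp: f_def Zvec_def lenF)
    fix y i assume y: "y \<in> Nvec p" and i: "i < k"
    show "f (0 # y) ! i = G i y"
      using y i by (simp add: f_app F0)
    fix x :: int assume x: "0 \<le> x"
    then have "nat (x + 1) = Suc (nat x)" by simp
    then show "f ((x + 1) # y) ! i - f (x # y) ! i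
        = (\<Sum>j<k. A i j (x # y) * f (x # y) ! j) + B i (x # y)"
      using y i x by (simp add: f_app FS step_def)
  qed
  moreover have "f1 = f2" if 1: "is_LI k p G A B f1" and 2: "is_LI k p G A B f2" for f1 f2
  proof -
    have ext: "f1 \<in> Nvec (Suc p) \<rightarrow>\<^sub>E Zvec k" "f2 \<in> Nvec (Suc p) \<rightarrow>\<^sub>E Zvec k"
      using 1 2 by (simp_all add: is_LI_def)
    have dom: "int n # y \<in> Nvec (Suc p)" if "y \<in> Nvec p" for n y
      using that by (simp add: Nvec_def)
    have len: "length (f1 (int n # y)) = k" "length (f2 (int n # y)) = k"
      if "y \<in> Nvec p" for n y
      using ext dom[OF that, of n] by (auto simp: Zvec_def PiE_iff)
    have eq: "f1 (int n # y) = f2 (int n # y)" if y: "y \<in> Nvec p" for n y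
    proof (induction n)
      case 0
      show ?case using 1 2 y len[OF y, of 0]
        by (intro nth_equalityI) (auto simp: is_LI_def)
    next
      case (Suc n)
      have s: "h ((int n + 1) # y) ! i = h (int n # y) ! i
          + (\<Sum>j<k. A i j (int n # y) * h (int n # y) ! j) + B i (int n # y)"
        if "is_LI k p G A B h" "i < k" for h i
      proof -
        have "delta (\<lambda>t. h (t # y) ! i) (int n)
          = (\<Sum>j<k. A i j (int n # y) * h (int n # y) ! j) + B i (int n # y)"
          using that y unfolding is_LI_def by simp
        then show ?thesis by (simp add: delta_def)
      qed
      have e: "int (Suc n) = int n + 1" by simp
      show ?case using len[OF y, of "Suc n"] s[OF 1] s[OF 2] Suc
        unfolding e by (intro nth_equalityI) simp_all
    qed
    show ?thesis
    proof (rule extensionalityI[of _ "Nvec (Suc p)"])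
      fix v assume "v \<in> Nvec (Suc p)"
      then obtain x y where "v = x # y" "0 \<le> x" "y \<in> Nvec p"
        by (cases v) (auto simp: Nvec_def)
      then show "f1 v = f2 v" using eq[of y "nat x"] by simp
    qed (use ext in \<open>auto simp: PiE_def\<close>)
  qed
  ultimately show ?thesis by blast
qed

text \<open>
  The class generated by composition and \<open>LI\<close> of dimensions in \<open>K\<close>. Its members are functions from
  some \<open>\<nat>\<^sup>p\<close> or \<open>\<int>\<^sup>p\<close> to some \<open>\<int>\<^sup>k\<close>; scalars are one-element lists. Composition is a partial
  operation: it needs the values of the inner functions to lie in the domain of the outer one,
  which matters as inner functions may take negative values. Inner functions may be vector-valued;
  \<open>projZ\<close> gives access to the components of solutions of \<open>LI\<close>.
\<close>

inductive_set ODE_class :: "nat set \<Rightarrow> (int list set \<times> (int list \<Rightarrow> int list)) set"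
  for K :: "nat set" where
  zero: "(Nvec p, \<lambda>v\<in>Nvec p. [0]) \<in> ODE_class K"
| projN: "i < p \<Longrightarrow> (Nvec p, \<lambda>v\<in>Nvec p. [v ! i]) \<in> ODE_class K"
| projZ: "i < p \<Longrightarrow> (Zvec p, \<lambda>v\<in>Zvec p. [v ! i]) \<in> ODE_class K"
| succ: "(Nvec 1, \<lambda>v\<in>Nvec 1. [v ! 0 + 1]) \<in> ODE_class K"
| add: "(Zvec 2, \<lambda>v\<in>Zvec 2. [v ! 0 + v ! 1]) \<in> ODE_class K"
| sub: "(Zvec 2, \<lambda>v\<in>Zvec 2. [v ! 0 - v ! 1]) \<in> ODE_class K"
| comp: "(E, h) \<in> ODE_class K \<Longrightarrow> D \<in> range Nvec \<union> range Zvec \<Longrightarrow>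
    (\<And>g. g \<in> set gs \<Longrightarrow> (D, g) \<in> ODE_class K) \<Longrightarrow>
    (\<And>v. v \<in> D \<Longrightarrow> concat (map (\<lambda>g. g v) gs) \<in> E) \<Longrightarrow>
    (D, \<lambda>v\<in>D. h (concat (map (\<lambda>g. g v) gs))) \<in> ODE_class K"
| LI: "k \<in> K \<Longrightarrow>
    (\<And>i. i < k \<Longrightarrow> (Nvec p, \<lambda>v\<in>Nvec p. [G i v]) \<in> ODE_class K) \<Longrightarrow>
    (\<And>i v. i < k \<Longrightarrow> v \<in> Nvec p \<Longrightarrow> 0 \<le> G i v) \<Longrightarrow>
    (\<And>i j. i < k \<Longrightarrow> j < k \<Longrightarrow>
      (Nvec (Suc p), \<lambda>v\<in>Nvec (Suc p). [A i j v]) \<in> ODE_class K) \<Longrightarrow>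
    (\<And>i. i < k \<Longrightarrow> (Nvec (Suc p), \<lambda>v\<in>Nvec (Suc p). [B i v]) \<in> ODE_class K) \<Longrightarrow>
    is_LI k p G A B f \<Longrightarrow>
    (Nvec (Suc p), f) \<in> ODE_class K"

definition vectorial_class :: "(int list set \<times> (int list \<Rightarrow> int list)) set" where
  "vectorial_class = ODE_class {1..}"

definition scalar_class :: "(int list set \<times> (int list \<Rightarrow> int list)) set" where
  "scalar_class = ODE_class {1}"

text \<open>The functions \<open>\<nat>\<^sup>p \<rightarrow> \<nat>\<close> in a class, up to the inclusion of \<open>\<nat>\<close> in \<open>\<int>\<close>.\<close>

definition nat_functions ::
  "(int list set \<times> (int list \<Rightarrow> int list)) set \<Rightarrow> (nat \<times> (nat list \<Rightarrow> nat)) set" where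
  "nat_functions C = {(p, f). f \<in> extensional (natvec p) \<and>
     (Nvec p, \<lambda>v\<in>Nvec p. [int (f (map nat v))]) \<in> C}"

end

theory Submission
  imports Defs
begin

text \<open>
  Bounded sums and products satisfy scalar linear equations: a sum has \<open>A = 0\<close> and
  \<open>B(x) = g(x + 1)\<close>, a product has \<open>A(x) = g(x + 1) - 1\<close> and \<open>B = 0\<close>. The sign function solves
  \<open>f' = 1 - f\<close>, and the product of \<open>sgn ((x - z)\<^sup>2)\<close> over \<open>z \<le> y\<close> decides \<open>y < x\<close>, which yields
  truncated subtraction. Conversely, the components of the functions on \<open>\<nat>\<^sup>p\<close> in the
  class are differences of elementary functions. For \<open>LI\<close>, positive and negative parts evolve under a
  linear recurrence with coefficients in \<open>\<nat>\<close>. Expanding the iterated matrix product as a sum over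
  paths, coded by numbers in base \<open>k\<close>, expresses the solution by one bounded sum of bounded products,
  so that no bound on the growth of the solution and no coding of its history is needed.
\<close>

section \<open>Closure properties of elementary functions\<close>

text \<open>The restriction sits inside the definition, so that closure facts can be stated for
  total functions whose values outside \<open>natvec p\<close> are irrelevant.\<close>

definition elem :: "nat \<Rightarrow> (nat list \<Rightarrow> nat) \<Rightarrow> bool" where
  "elem p f \<longleftrightarrow> (p, restrict f (natvec p)) \<in> elementary"

lemma elem_cong: "(\<And>v. length v = p \<Longrightarrow> f v = g v) \<Longrightarrow> elem p f \<longleftrightarrow> elem p g"
proof -
  assume "\<And>v. length v = p \<Longrightarrow> f v = g v"
  then have "restrict f (natvec p) = restrict g (natvec p)"
    by (auto simp: natvec_def)
  then show ?thesis by (simp add: elem_def)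
qed

lemma elem_comp:
  assumes "elem (length gs) h" "\<And>g. g \<in> set gs \<Longrightarrow> elem p g"
  shows "elem p (\<lambda>v. h (map (\<lambda>g. g v) gs))"
proof -
  let ?gs = "map (\<lambda>g. restrict g (natvec p)) gs"
  have "(p, \<lambda>v\<in>natvec p. restrict h (natvec (length gs)) (map (\<lambda>g. g v) ?gs)) \<in> elementary"
    by (rule elementary.comp[of ?gs "restrict h (natvec (length gs))"])
      (use assms in \<open>auto simp: elem_def\<close>)
  also have "(\<lambda>v\<in>natvec p. restrict h (natvec (length gs)) (map (\<lambda>g. g v) ?gs)) =
      (\<lambda>v\<in>natvec p. h (map (\<lambda>g. g v) gs))"
    by (auto simp: natvec_def comp_def fun_eq_iff)
  finally show ?thesis unfolding elem_def .
qed

lemma elem_proj: "i < p \<Longrightarrow> elem p (\<lambda>v. v ! i)"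
  unfolding elem_def by (rule elementary.proj)

lemma elem_hd: "elem (Suc p) hd"
proof -
  have "elem (Suc p) (\<lambda>v. v ! 0)" by (rule elem_proj) simp
  then show ?thesis
    by (rule elem_cong[THEN iffD1, rotated]) (auto simp: hd_conv_nth length_Suc_conv)
qed

text \<open>Adds a dummy first argument. Throughout, the head of a list is the variable bound by a
  sum or product and the tail holds the parameters.\<close>

lemma elem_tl:
  assumes "elem p f" shows "elem (Suc p) (\<lambda>w. f (tl w))"
proof -
  have "elem (Suc p) (\<lambda>w. f (map (\<lambda>g. g w) (map (\<lambda>i w. w ! Suc i) [0..<p])))"
    by (rule elem_comp) (use assms in \<open>auto intro: elem_proj\<close>)
  moreover have "map (\<lambda>g. g w) (map (\<lambda>i w. w ! Suc i) [0..<p]) = tl w"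
    if "length w = Suc p" for w :: "nat list"
    using that by (intro nth_equalityI) (auto simp: nth_tl)
  ultimately show ?thesis by (subst elem_cong) auto
qed

lemma elem_subst:
  assumes "elem (Suc p) g" "elem p b" shows "elem p (\<lambda>v. g (b v # v))"
proof -
  have "elem p (\<lambda>v. g (map (\<lambda>g. g v) (b # map (\<lambda>i v. v ! i) [0..<p])))"
    by (rule elem_comp) (use assms in \<open>auto intro: elem_proj\<close>)
  moreover have "map (\<lambda>g. g w) (map (\<lambda>i w. w ! i) [0..<p]) = w"
    if "length w = p" for w :: "nat list"
    using that by (intro nth_equalityI) auto
  ultimately show ?thesis by (subst elem_cong) auto
qed

text \<open>Adds a dummy argument in second position, so that a function of an index and parameters
  can be used beneath further bound variables.\<close>

lemma elem_insert:
  assumes "elem (Suc p) h" shows "elem (Suc (Suc p)) (\<lambda>w. h (hd w # tl (tl w)))"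
proof -
  have "elem (Suc (Suc p)) (\<lambda>w. h (map (\<lambda>g. g w) (hd # map (\<lambda>i w. w ! Suc (Suc i)) [0..<p])))"
    by (rule elem_comp) (use assms in \<open>auto intro: elem_proj elem_hd\<close>)
  moreover have "map (\<lambda>g. g w) (map (\<lambda>i w. w ! Suc (Suc i)) [0..<p]) = tl (tl w)"
    if "length w = Suc (Suc p)" for w :: "nat list"
    using that by (intro nth_equalityI) (auto simp: nth_tl)
  ultimately show ?thesis by (subst elem_cong) auto
qed

lemma elem_add:
  assumes "elem p f" "elem p g" shows "elem p (\<lambda>v. f v + g v)"
  using elem_comp[of "[f, g]" "\<lambda>v. v ! 0 + v ! 1" p] elementary.add assms
  by (auto simp: elem_def numeral_2_eq_2)

lemma elem_monus:
  assumes "elem p f" "elem p g" shows "elem p (\<lambda>v. f v - g v)"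
  using elem_comp[of "[f, g]" "\<lambda>v. v ! 0 - v ! 1" p] elementary.monus assms
  by (auto simp: elem_def numeral_2_eq_2)

lemma elem_Suc:
  assumes "elem p f" shows "elem p (\<lambda>v. Suc (f v))"
  using elem_comp[of "[f]" "\<lambda>v. v ! 0 + 1" p] elementary.succ assms
  by (simp add: elem_def)

lemma elem_const: "elem p (\<lambda>v. n)"
proof (induction n)
  case 0
  show ?case unfolding elem_def by (rule elementary.zero)
qed (rule elem_Suc)

text \<open>The generating rule sums up to its own first argument; an arbitrary bound
  \<open>b\<close> is obtained by substituting it for that argument.\<close>

lemma elem_sum:
  assumes "elem (Suc p) (\<lambda>w. g (hd w) (tl w))" "elem p b"
  shows "elem p (\<lambda>v. \<Sum>z\<le>b v. g z v)"
proof -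
  have "elem (Suc p) (\<lambda>v. \<Sum>z\<le>hd v. restrict (\<lambda>w. g (hd w) (tl w)) (natvec (Suc p)) (z # tl v))"
    unfolding elem_def
    by (rule elementary.bsum[of _ "restrict _ _"]) (use assms in \<open>simp add: elem_def\<close>)
  from elem_subst[OF this assms(2)] show ?thesis
    by (rule elem_cong[THEN iffD1, rotated]) (auto simp: natvec_def)
qed

lemma elem_prod:
  assumes "elem (Suc p) (\<lambda>w. g (hd w) (tl w))" "elem p b"
  shows "elem p (\<lambda>v. \<Prod>z\<le>b v. g z v)"
proof -
  have "elem (Suc p) (\<lambda>v. \<Prod>z\<le>hd v. restrict (\<lambda>w. g (hd w) (tl w)) (natvec (Suc p)) (z # tl v))"
    unfolding elem_def
    by (rule elementary.bprod[of _ "restrict _ _"]) (use assms in \<open>simp add: elem_def\<close>)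
  from elem_subst[OF this assms(2)] show ?thesis
    by (rule elem_cong[THEN iffD1, rotated]) (auto simp: natvec_def)
qed

text \<open>Removing the last term by truncated subtraction is exact, because that term is one of
  the summands.\<close>

lemma elem_sum_less:
  assumes "elem (Suc p) (\<lambda>w. g (hd w) (tl w))" "elem p b"
  shows "elem p (\<lambda>v. \<Sum>z<b v. g z v)"
proof -
  have "elem p (\<lambda>v. (\<Sum>z\<le>b v. g z v) - g (b v) v)"
    using elem_monus[OF elem_sum[OF assms] elem_subst[OF assms]] by simp
  moreover have "(\<Sum>z\<le>b v. g z v) - g (b v) v = (\<Sum>z<b v. g z v)" for v
    by (simp flip: lessThan_Suc_atMost)
  ultimately show ?thesis by simp
qed

text \<open>A product of two values is a sum of \<open>f v\<close> copies of
  \<open>g v\<close>.\<close>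

lemma elem_mult:
  assumes "elem p f" "elem p g" shows "elem p (\<lambda>v. f v * g v)"
  using elem_sum_less[of p "\<lambda>_. g" f] elem_tl[OF assms(2)] assms(1) by simp

lemma elem_less:
  assumes "elem p f" "elem p g" shows "elem p (\<lambda>v. of_bool (f v < g v))"
proof -
  have "elem p (\<lambda>v. 1 - (1 - (g v - f v)))"
    by (intro elem_monus elem_const assms)
  moreover have "1 - (1 - (g v - f v)) = of_bool (f v < g v)" for v
    by auto
  ultimately show ?thesis by simp
qed

lemma elem_eq:
  assumes "elem p f" "elem p g" shows "elem p (\<lambda>v. of_bool (f v = g v))"
proof -
  have "elem p (\<lambda>v. (1 - (f v - g v)) * (1 - (g v - f v)))"
    by (intro elem_monus elem_mult elem_const assms)
  moreover have "(1 - (f v - g v)) * (1 - (g v - f v)) = of_bool (f v = g v)" for v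
    by auto
  ultimately show ?thesis by simp
qed

text \<open>The last factor may be 0 and cannot be divided out, so it is replaced by 1 with the help
  of indicators.\<close>

lemma elem_prod_less:
  assumes "elem (Suc p) (\<lambda>w. g (hd w) (tl w))" "elem p b"
  shows "elem p (\<lambda>v. \<Prod>z<b v. g z v)"
proof -
  have "elem p (\<lambda>v. \<Prod>z\<le>b v. of_bool (z < b v) * g z v + of_bool (b v = z))"
    by (intro elem_prod elem_add elem_mult elem_less elem_eq elem_hd elem_tl assms)
  moreover have "(\<Prod>z\<le>b v. of_bool (z < b v) * g z v + of_bool (b v = z)) = (\<Prod>z<b v. g z v)" for v
    by (simp flip: lessThan_Suc_atMost)
  ultimately show ?thesis by simp
qed

lemma elem_power:
  assumes "elem p f" "elem p g" shows "elem p (\<lambda>v. f v ^ g v)"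
  using elem_prod_less[of p "\<lambda>_. f" g] elem_tl[OF assms(1)] assms(2) by simp

text \<open>The quotient counts the \<open>z\<close> with \<open>(z + 1) * g v \<le> f v\<close>.
  All of them lie below \<open>f v\<close>, so this bound loses none.\<close>

lemma elem_div:
  assumes "elem p f" "elem p g" "\<And>v. g v > 0" shows "elem p (\<lambda>v. f v div g v)"
proof -
  have "elem p (\<lambda>v. \<Sum>z<f v. of_bool (z * g v + g v < Suc (f v)))"
    by (intro elem_sum_less elem_less elem_add elem_mult elem_Suc elem_hd elem_tl assms)
  moreover have "(\<Sum>z<f v. of_bool (z * g v + g v < Suc (f v))) = f v div g v" for v
  proof -
    have "z * g v + g v < Suc (f v) \<longleftrightarrow> z < f v div g v" for z
      using less_eq_div_iff_mult_less_eq[of "g v" "Suc z" "f v"] assms(3)[of v]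
      by (simp add: add.commute less_Suc_eq_le Suc_le_eq)
    moreover have "z < f v" if "z < f v div g v" for z
      using that div_le_dividend[of "f v" "g v"] by linarith
    ultimately have "{..<f v} \<inter> {z. z * g v + g v < Suc (f v)} = {..<f v div g v}"
      by auto
    then show ?thesis by (simp add: of_bool_def sum.If_cases)
  qed
  ultimately show ?thesis by simp
qed

lemma elem_mod:
  assumes "elem p f" "elem p g" "\<And>v. g v > 0" shows "elem p (\<lambda>v. f v mod g v)"
  unfolding minus_mult_div_eq_mod[symmetric]
  by (intro elem_monus elem_mult elem_div assms)

lemma elem_finite_sum:
  "(\<And>i::nat. i < k \<Longrightarrow> elem p (g i)) \<Longrightarrow> elem p (\<lambda>v. \<Sum>i<k. g i v)"
  by (induction k) (auto intro: elem_const elem_add)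

text \<open>The condition \<open>P\<close> does not depend on \<open>v\<close>: this is a case split
  on fixed indices, and each branch is only considered in its own case.\<close>

lemma elem_if:
  assumes "P \<Longrightarrow> elem p f" "\<not> P \<Longrightarrow> elem p g" shows "elem p (\<lambda>v. if P then f v else g v)"
  using assms by (cases P) simp_all

text \<open>Here the choice among the finitely many \<open>g i\<close> does depend on
  \<open>v\<close>; a finite sum weighted by indicators of \<open>f v = i\<close> performs
  it.\<close>

lemma elem_select:
  assumes "\<And>i. i < k \<Longrightarrow> elem p (g i)" "elem p f" "\<And>v. f v < k"
  shows "elem p (\<lambda>v. g (f v) v)"
proof -
  have "elem p (\<lambda>v. \<Sum>i<k. of_bool (f v = i) * g i v)"
    by (intro elem_finite_sum elem_mult elem_eq elem_const assms) auto
  moreover have "(\<Sum>i<k. of_bool (f v = i) * g i v) = g (f v) v" for v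
    using assms(3)[of v] by (simp add: of_bool_def if_distrib[of "\<lambda>x. x * _"] cong: if_cong)
  ultimately show ?thesis by simp
qed

section \<open>Linear recurrences\<close>

text \<open>This is the homogeneous recurrence \<open>f (x + 1) = A x * f x\<close>, not the
  difference equation. The identity matrix and the inhomogeneous term are absorbed into the matrix
  later.\<close>

primrec lin_sol ::
  "nat \<Rightarrow> (nat \<Rightarrow> nat \<Rightarrow> nat \<Rightarrow> nat) \<Rightarrow> (nat \<Rightarrow> nat) \<Rightarrow> nat \<Rightarrow> nat \<Rightarrow> nat" where
  "lin_sol k A G 0 i = G i"
| "lin_sol k A G (Suc x) i = (\<Sum>j<k. A x i j * lin_sol k A G x j)"

text \<open>The base-\<open>k\<close> digits of \<open>c\<close> are read as a path through the states \<open>0, \<dots>, k - 1\<close>.\<close>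

definition path_weight ::
  "nat \<Rightarrow> (nat \<Rightarrow> nat \<Rightarrow> nat \<Rightarrow> nat) \<Rightarrow> (nat \<Rightarrow> nat) \<Rightarrow> nat \<Rightarrow> nat \<Rightarrow> nat" where
  "path_weight k A G x c =
     G (c mod k) * (\<Prod>t<x. A t (c div k ^ Suc t mod k) (c div k ^ t mod k))"

text \<open>A new leading digit \<open>i\<close> leaves the lower digits alone, so the only new
  factor is the one at \<open>t = x\<close>, between the two top digits \<open>j\<close> and
  \<open>i\<close>.\<close>

lemma path_weight_Suc:
  assumes "i < k" "j < k" "c < k ^ x"
  shows "path_weight k A G (Suc x) (i * k ^ Suc x + (j * k ^ x + c)) =
    A x i j * path_weight k A G x (j * k ^ x + c)"
proof -
  let ?d = "j * k ^ x + c"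
  let ?e = "i * k ^ Suc x + ?d"
  have d: "?d < k ^ Suc x"
  proof -
    have "?d < Suc j * k ^ x" using assms by simp
    also have "\<dots> \<le> k * k ^ x" using assms by (intro mult_right_mono) auto
    finally show ?thesis by simp
  qed
  \<comment> \<open>For \<open>t \<le> x\<close> the added term \<open>i * k ^ Suc x\<close> is a
    multiple of \<open>k ^ Suc t\<close> and does not reach digit \<open>t\<close>.\<close>
  have low: "?e div k ^ t mod k = ?d div k ^ t mod k" if "t \<le> x" for t
  proof -
    have "k ^ Suc x = k ^ t * (k * k ^ (x - t))"
      using that by (simp flip: power_add)
    then have "?e = ?d + k ^ t * (k * (k ^ (x - t) * i))" by (simp add: algebra_simps)
    then have "?e div k ^ t = (?d + k ^ t * (k * (k ^ (x - t) * i))) div k ^ t" by (rule arg_cong)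
    also have "\<dots> = k * (k ^ (x - t) * i) + ?d div k ^ t"
      using assms by (intro div_mult_self2) auto
    finally show ?thesis by simp
  qed
  have top: "?e div k ^ Suc x mod k = i" "?d div k ^ x mod k = j"
    using assms d by (simp_all del: power_Suc)
  have "(\<Prod>t<x. A t (?e div k ^ Suc t mod k) (?e div k ^ t mod k)) =
      (\<Prod>t<x. A t (?d div k ^ Suc t mod k) (?d div k ^ t mod k))"
    by (intro prod.cong refl) (simp only: low lessThan_iff Suc_leI less_imp_le)
  moreover have "?e mod k = ?d mod k" using low[of 0] by simp
  moreover have "?e div k ^ x mod k = j" using low[of x] top by simp
  ultimately show ?thesis
    unfolding path_weight_def prod.lessThan_Suc top by (simp only: mult_ac)
qed

text \<open>Digit 0 is the initial state and digit \<open>x\<close> the final state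
  \<open>i\<close>; \<open>c\<close> runs over all choices of the digits below.\<close>

lemma lin_sol_eq_sum_paths:
  "i < k \<Longrightarrow> lin_sol k A G x i = (\<Sum>c<k ^ x. path_weight k A G x (i * k ^ x + c))"
proof (induction x arbitrary: i)
  case 0
  then show ?case by (simp add: path_weight_def)
next
  case (Suc x)
  let ?W = "\<lambda>c. path_weight k A G (Suc x) (i * k ^ Suc x + c)"
  \<comment> \<open>The codes fall into \<open>k\<close> blocks of length \<open>k ^ x\<close>, one
    for each state \<open>j\<close> before the last transition.\<close>
  have "(\<Sum>c<k ^ Suc x. ?W c) = (\<Sum>j<k. sum ?W {j * k ^ x..<j * k ^ x + k ^ x})"
    by (simp only: sum.nat_group power_Suc)
  also have "\<dots> = (\<Sum>j<k. \<Sum>c<k ^ x. ?W (j * k ^ x + c))"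
    using sum.shift_bounds_nat_ivl[of ?W 0 "j * k ^ x" "k ^ x" for j]
    by (simp add: add.commute lessThan_atLeast0 del: power_Suc)
  also have "\<dots> = (\<Sum>j<k. A x i j * lin_sol k A G x j)"
    using Suc by (simp add: path_weight_Suc sum_distrib_left del: power_Suc)
  finally show ?case by simp
qed

lemma elem_lin_sol:
  assumes G: "\<And>i. i < k \<Longrightarrow> elem p (G i)"
    and A: "\<And>i j. i < k \<Longrightarrow> j < k \<Longrightarrow> elem (Suc p) (\<lambda>w. A i j (hd w) (tl w))"
    and i: "i < k"
  shows "elem (Suc p) (\<lambda>w. lin_sol k (\<lambda>x i j. A i j x (tl w)) (\<lambda>i. G i (tl w)) (hd w) i)"
proof -
  have k: "k > 0" using i by simp
  have c: "elem (Suc (Suc p)) (\<lambda>w. i * k ^ hd (tl w) + hd w)"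
    by (intro elem_add elem_mult elem_power elem_const elem_hd elem_tl)
  have A': "elem (Suc (Suc (Suc p))) (\<lambda>w. A i j (hd w) (tl (tl (tl w))))" if "i < k" "j < k" for i j
    using elem_insert[OF elem_insert[OF A[OF that]]] by simp
  have digit: "elem (Suc q) (\<lambda>w. f (tl w) div k ^ g w mod k)"
    if "elem q f" "elem (Suc q) g" for q f g
    by (intro elem_mod elem_div elem_power elem_const elem_tl that) (use k in auto)
  \<comment> \<open>Here \<open>w\<close> is \<open>t # c # x # y\<close>: factor index, path code,
    time, parameters.\<close>
  have "elem (Suc (Suc (Suc p))) (\<lambda>w. A
      ((i * k ^ hd (tl (tl w)) + hd (tl w)) div k ^ Suc (hd w) mod k)
      ((i * k ^ hd (tl (tl w)) + hd (tl w)) div k ^ hd w mod k) (hd w) (tl (tl (tl w))))"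
    (is "elem _ (\<lambda>w. A (?d w) (?e w) _ _)")
  \<comment> \<open>The indices of \<open>A\<close> are computed digits, hence two selections, first
    of the row and then of the column. Both digits are below \<open>k\<close> by
    \<open>mod k\<close>.\<close>
  proof (rule elem_select[where f = ?d and g = "\<lambda>i w. A i (?e w) (hd w) (tl (tl (tl w)))"])
    show "elem (Suc (Suc (Suc p))) ?d"
      by (intro digit[OF c] elem_Suc elem_hd)
    fix i assume "i < k"
    show "elem (Suc (Suc (Suc p))) (\<lambda>w. A i (?e w) (hd w) (tl (tl (tl w))))"
      by (rule elem_select[where f = ?e and g = "\<lambda>j w. A i j (hd w) (tl (tl (tl w)))"])
        (use k \<open>i < k\<close> in \<open>auto intro!: A' digit[OF c] elem_hd simp del: power_Suc\<close>)
  qed (use k in auto)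
  moreover have "elem (Suc (Suc p)) (\<lambda>w. G ((i * k ^ hd (tl w) + hd w) mod k) (tl (tl w)))"
    by (rule elem_select[where f = "\<lambda>w. (i * k ^ hd (tl w) + hd w) mod k" and g = "\<lambda>i w. G i (tl (tl w))"])
      (use k in \<open>auto intro!: elem_mod elem_const c elem_tl G\<close>)
  ultimately have "elem (Suc p) (\<lambda>w. \<Sum>c<k ^ hd w. path_weight k (\<lambda>x i j. A i j x (tl w))
      (\<lambda>i. G i (tl w)) (hd w) (i * k ^ hd w + c))"
    unfolding path_weight_def
    by (intro elem_sum_less elem_mult elem_prod_less elem_power elem_const elem_hd elem_tl)
  then show ?thesis by (simp only: lin_sol_eq_sum_paths[OF i])
qed

section \<open>Differences of elementary functions\<close>

definition elem_diff :: "nat \<Rightarrow> (nat list \<Rightarrow> int) \<Rightarrow> bool" where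
  "elem_diff p f \<longleftrightarrow> (\<exists>u w. elem p u \<and> elem p w \<and> (\<forall>v\<in>natvec p. f v = int (u v) - int (w v)))"

lemma elem_diff_cong: "(\<And>v. length v = p \<Longrightarrow> f v = g v) \<Longrightarrow> elem_diff p f \<longleftrightarrow> elem_diff p g"
  by (simp add: elem_diff_def natvec_def)

lemma elem_diff_int: "elem p f \<Longrightarrow> elem_diff p (\<lambda>v. int (f v))"
  unfolding elem_diff_def by (rule exI[of _ f], rule exI[of _ "\<lambda>_. 0"]) (simp add: elem_const)

lemma elem_diff_diff_int: "elem p f \<Longrightarrow> elem p g \<Longrightarrow> elem_diff p (\<lambda>v. int (f v) - int (g v))"
  unfolding elem_diff_def by blast

lemma elem_diff_add:
  assumes "elem_diff p f" "elem_diff p g" shows "elem_diff p (\<lambda>v. f v + g v)"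
proof -
  from assms obtain u w u' w' where *: "elem p u" "elem p w" "elem p u'" "elem p w'"
    and f: "\<And>v. length v = p \<Longrightarrow> f v = int (u v) - int (w v)"
    and g: "\<And>v. length v = p \<Longrightarrow> g v = int (u' v) - int (w' v)"
    by (auto simp: elem_diff_def natvec_def)
  have "elem_diff p (\<lambda>v. int (u v + u' v) - int (w v + w' v))"
    by (intro elem_diff_diff_int elem_add *)
  then show ?thesis by (rule elem_diff_cong[THEN iffD1, rotated]) (simp add: f g)
qed

lemma elem_diff_diff:
  assumes "elem_diff p f" "elem_diff p g" shows "elem_diff p (\<lambda>v. f v - g v)"
proof -
  from assms obtain u w u' w' where *: "elem p u" "elem p w" "elem p u'" "elem p w'"
    and f: "\<And>v. length v = p \<Longrightarrow> f v = int (u v) - int (w v)"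
    and g: "\<And>v. length v = p \<Longrightarrow> g v = int (u' v) - int (w' v)"
    by (auto simp: elem_diff_def natvec_def)
  have "elem_diff p (\<lambda>v. int (u v + w' v) - int (w v + u' v))"
    by (intro elem_diff_diff_int elem_add *)
  then show ?thesis by (rule elem_diff_cong[THEN iffD1, rotated]) (simp add: f g)
qed

text \<open>Leads back from integers to naturals: a nonnegative difference agrees with truncated
  subtraction.\<close>

lemma elem_diff_nonneg:
  assumes "elem_diff p f" "\<And>v. length v = p \<Longrightarrow> 0 \<le> f v" shows "elem p (\<lambda>v. nat (f v))"
proof -
  from assms(1) obtain u w where *: "elem p u" "elem p w"
    and f: "\<And>v. length v = p \<Longrightarrow> f v = int (u v) - int (w v)"
    by (auto simp: elem_diff_def natvec_def)
  have "elem p (\<lambda>v. u v - w v)" by (intro elem_monus *)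
  then show ?thesis by (rule elem_cong[THEN iffD1, rotated]) (use f in simp)
qed

lemma elem_diff_comp:
  assumes "elem_diff (length gs) h" "\<And>g. g \<in> set gs \<Longrightarrow> elem p g"
  shows "elem_diff p (\<lambda>v. h (map (\<lambda>g. g v) gs))"
proof -
  from assms(1) obtain u w where *: "elem (length gs) u" "elem (length gs) w"
    and h: "\<And>v. length v = length gs \<Longrightarrow> h v = int (u v) - int (w v)"
    by (auto simp: elem_diff_def natvec_def)
  show ?thesis unfolding h[of "map _ gs", simplified]
    by (intro elem_diff_diff_int elem_comp * assms)
qed

text \<open>
  State \<open>s < k\<close> is the positive part of component \<open>s\<close>, state \<open>k + s\<close> its negative part, and the
  constant state \<open>2 * k\<close> carries the inhomogeneous term.
\<close>

definition split_system ::
  "nat \<Rightarrow> (nat \<Rightarrow> nat \<Rightarrow> 'a \<Rightarrow> nat) \<Rightarrow> (nat \<Rightarrow> nat \<Rightarrow> 'a \<Rightarrow> nat) \<Rightarrow> (nat \<Rightarrow> 'a \<Rightarrow> nat) \<Rightarrow> (nat \<Rightarrow> 'a \<Rightarrow> nat) \<Rightarrow>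
    nat \<Rightarrow> nat \<Rightarrow> 'a \<Rightarrow> nat" where
  "split_system k U V b c s t w =
    (if s < k then
       if t < k then U s t w else if t < 2 * k then V s (t - k) w else b s w
     else if s < 2 * k then
       if t < k then V (s - k) t w else if t < 2 * k then U (s - k) (t - k) w else c (s - k) w
     else of_bool (t = 2 * k))"

lemma sum_split_states:
  fixes f :: "nat \<Rightarrow> 'a::comm_monoid_add"
  shows "(\<Sum>s<Suc (2 * k). f s) = (\<Sum>j<k. f j) + (\<Sum>j<k. f (k + j)) + f (2 * k)"
proof -
  have "(\<Sum>s<2 * k. f s) = (\<Sum>j<k. f j) + (\<Sum>s=k..<2 * k. f s)"
    using sum.atLeastLessThan_concat[of 0 k "2 * k" f] by (simp add: lessThan_atLeast0)
  also have "(\<Sum>s=k..<2 * k. f s) = (\<Sum>j<k. f (k + j))"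
    using sum.shift_bounds_nat_ivl[of f 0 k k] by (simp add: lessThan_atLeast0 mult_2 add.commute)
  finally show ?thesis by simp
qed

text \<open>Uses \<open>(U - V) * (P - N) = (U * P + V * N) - (V * P + U * N)\<close>. State
  \<open>2 * k\<close> starts at 1 and stays there, so its coefficients \<open>b\<close> and
  \<open>c\<close> enter as added terms. Only the difference of the two parts matters; they need not
  be minimal.\<close>

lemma split_system_sol:
  fixes h :: "nat \<Rightarrow> nat \<Rightarrow> int"
  assumes G: "\<And>i. i < k \<Longrightarrow> h 0 i = int (gu i) - int (gv i)"
    and step: "\<And>x i. i < k \<Longrightarrow> h (Suc x) i =
      (\<Sum>j<k. (int (U i j x) - int (V i j x)) * h x j) + (int (b i x) - int (c i x))"
  defines "F \<equiv> lin_sol (Suc (2 * k)) (\<lambda>x i j. split_system k U V b c i j x)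
      (\<lambda>i. if i < k then gu i else if i < 2 * k then gv (i - k) else 1)"
  shows "F x (2 * k) = 1 \<and> (\<forall>i<k. h x i = int (F x i) - int (F x (k + i)))"
proof (induction x)
  case 0
  show ?case by (simp add: F_def G)
next
  case (Suc x)
  have F: "F (Suc x) i = (\<Sum>j<Suc (2 * k). split_system k U V b c i j x * F x j)" for i
    by (simp only: F_def lin_sol.simps)
  have "F (Suc x) (2 * k) = 1"
    unfolding F sum_split_states using Suc by (simp add: split_system_def)
  moreover have "h (Suc x) i = int (F (Suc x) i) - int (F (Suc x) (k + i))" if i: "i < k" for i
  proof -
    have P: "F (Suc x) i = (\<Sum>j<k. U i j x * F x j) + (\<Sum>j<k. V i j x * F x (k + j)) + b i x"
      unfolding F sum_split_states using Suc i by (simp add: split_system_def)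
    have N: "F (Suc x) (k + i) = (\<Sum>j<k. V i j x * F x j) + (\<Sum>j<k. U i j x * F x (k + j)) + c i x"
      unfolding F sum_split_states using Suc i by (simp add: split_system_def)
    have "h (Suc x) i = (\<Sum>j<k. (int (U i j x) - int (V i j x)) * (int (F x j) - int (F x (k + j))))
        + (int (b i x) - int (c i x))"
      using step[OF i] Suc by simp
    also have "\<dots> = int (F (Suc x) i) - int (F (Suc x) (k + i))"
      unfolding P N by (simp add: algebra_simps sum.distrib sum_subtractf)
    finally show ?thesis .
  qed
  ultimately show ?case by blast
qed

lemma elem_diff_linear_system:
  fixes h :: "nat \<Rightarrow> nat \<Rightarrow> nat list \<Rightarrow> int"
  assumes G: "\<And>i. i < k \<Longrightarrow> elem_diff p (G i)"
    and A: "\<And>i j. i < k \<Longrightarrow> j < k \<Longrightarrow> elem_diff (Suc p) (A i j)"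
    and B: "\<And>i. i < k \<Longrightarrow> elem_diff (Suc p) (B i)"
    and h0: "\<And>i y. i < k \<Longrightarrow> length y = p \<Longrightarrow> h 0 i y = G i y"
    and hS: "\<And>i x y. i < k \<Longrightarrow> length y = p \<Longrightarrow>
      h (Suc x) i y = (\<Sum>j<k. A i j (x # y) * h x j y) + B i (x # y)"
    and i: "i < k"
  shows "elem_diff (Suc p) (\<lambda>w. h (hd w) i (tl w))"
proof -
  from G have "\<forall>i. \<exists>u v. i < k \<longrightarrow> elem p u \<and> elem p v \<and> (\<forall>y\<in>natvec p. G i y = int (u y) - int (v y))"
    unfolding elem_diff_def by blast
  then obtain gu gv where g: "\<And>i. i < k \<Longrightarrow> elem p (gu i)" "\<And>i. i < k \<Longrightarrow> elem p (gv i)"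
    and geq: "\<And>i y. i < k \<Longrightarrow> length y = p \<Longrightarrow> G i y = int (gu i y) - int (gv i y)"
    unfolding natvec_def by (simp only: choice_iff mem_Collect_eq) blast
  from B have "\<forall>i. \<exists>u v. i < k \<longrightarrow> elem (Suc p) u \<and> elem (Suc p) v \<and>
      (\<forall>y\<in>natvec (Suc p). B i y = int (u y) - int (v y))"
    unfolding elem_diff_def by blast
  then obtain b c where b: "\<And>i. i < k \<Longrightarrow> elem (Suc p) (b i)" "\<And>i. i < k \<Longrightarrow> elem (Suc p) (c i)"
    and beq: "\<And>i y. i < k \<Longrightarrow> length y = Suc p \<Longrightarrow> B i y = int (b i y) - int (c i y)"
    unfolding natvec_def by (simp only: choice_iff mem_Collect_eq) blast
  from A have "\<forall>i j. \<exists>u v. i < k \<longrightarrow> j < k \<longrightarrow> elem (Suc p) u \<and> elem (Suc p) v \<and>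
      (\<forall>y\<in>natvec (Suc p). A i j y = int (u y) - int (v y))"
    unfolding elem_diff_def by blast
  then obtain U V where U: "\<And>i j. i < k \<Longrightarrow> j < k \<Longrightarrow> elem (Suc p) (U i j)"
      "\<And>i j. i < k \<Longrightarrow> j < k \<Longrightarrow> elem (Suc p) (V i j)"
    and Ueq: "\<And>i j y. i < k \<Longrightarrow> j < k \<Longrightarrow> length y = Suc p \<Longrightarrow> A i j y = int (U i j y) - int (V i j y)"
    unfolding natvec_def by (simp only: choice_iff mem_Collect_eq) blast
  \<comment> \<open>The recurrence keeps time and parameters apart, while the coefficients take them
    as one list.\<close>
  have cons: "elem (Suc p) (\<lambda>w. f (hd w # tl w))" if "elem (Suc p) f" for f
    using that by (rule elem_cong[THEN iffD1, rotated]) (auto simp: length_Suc_conv)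
  define S where "S = (\<lambda>i j x y. split_system k U V b c i j (x # y))"
  define g where "g = (\<lambda>i y. if i < k then gu i y else if i < 2 * k then gv (i - k) y else 1)"
  define F where "F = (\<lambda>x s y. lin_sol (Suc (2 * k)) (\<lambda>x i j. S i j x y) (\<lambda>i. g i y) x s)"
  have F: "elem (Suc p) (\<lambda>w. F (hd w) s (tl w))" if "s < Suc (2 * k)" for s
    unfolding F_def
  proof (rule elem_lin_sol)
    fix i show "elem p (g i)"
      unfolding g_def by (intro elem_if g elem_const) auto
  next
    fix i j assume "i < Suc (2 * k)" "j < Suc (2 * k)"
    then show "elem (Suc p) (\<lambda>w. S i j (hd w) (tl w))"
      unfolding S_def split_system_def
        by (intro elem_if U[THEN cons] b[THEN cons] elem_const) auto
  qed (rule that)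
  have sol: "h x i y = int (F x i y) - int (F x (k + i) y)" if y: "length y = p" for x y
  proof -
    have "(\<forall>i<k. h x i y = int (F x i y) - int (F x (k + i) y))"
      using split_system_sol[where h = "\<lambda>x i. h x i y" and k = k and x = x
          and gu = "\<lambda>i. gu i y" and gv = "\<lambda>i. gv i y"
          and U = "\<lambda>i j x. U i j (x # y)" and V = "\<lambda>i j x. V i j (x # y)"
          and b = "\<lambda>i x. b i (x # y)" and c = "\<lambda>i x. c i (x # y)"]
        h0 hS geq beq Ueq y
      by (simp add: F_def S_def g_def split_system_def)
    then show ?thesis using i by blast
  qed
  have "elem_diff (Suc p) (\<lambda>w. int (F (hd w) i (tl w)) - int (F (hd w) (k + i) (tl w)))"
    using i by (intro elem_diff_diff_int F) auto
  then show ?thesis by (rule elem_diff_cong[THEN iffD1, rotated]) (simp add: sol)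
qed

section \<open>Vector-valued functions and the invariant of the class\<close>

definition elem_diff_vec :: "nat \<Rightarrow> (nat list \<Rightarrow> int list) \<Rightarrow> bool" where
  "elem_diff_vec p f \<longleftrightarrow> (\<exists>k. (\<forall>v\<in>natvec p. length (f v) = k) \<and> (\<forall>i<k. elem_diff p (\<lambda>v. f v ! i)))"

lemma elem_diff_vec_cong: "(\<And>v. length v = p \<Longrightarrow> f v = g v) \<Longrightarrow> elem_diff_vec p f \<longleftrightarrow> elem_diff_vec p g"
  unfolding elem_diff_vec_def
    by (intro iff_exI conj_cong ball_cong all_cong1 imp_cong elem_diff_cong refl)
    (simp_all add: natvec_def)

lemma elem_diff_vec_nth:
  assumes "elem_diff_vec p f" "\<And>v. length v = p \<Longrightarrow> i < length (f v)"
  shows "elem_diff p (\<lambda>v. f v ! i)"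
proof -
  from assms(1) obtain k where k: "\<And>v. length v = p \<Longrightarrow> length (f v) = k"
      "\<And>i. i < k \<Longrightarrow> elem_diff p (\<lambda>v. f v ! i)"
    by (auto simp: elem_diff_vec_def natvec_def)
  \<comment> \<open>Any sample point relates the pointwise bound on \<open>i\<close> to the constant
    length \<open>k\<close>; the zero vector shows that there is one.\<close>
  have "i < k" using assms(2)[of "replicate p 0"] k(1)[of "replicate p 0"] by simp
  then show ?thesis by (rule k)
qed

lemma elem_diff_vec_single: "elem_diff p f \<Longrightarrow> elem_diff_vec p (\<lambda>v. [f v])"
  unfolding elem_diff_vec_def by (rule exI[of _ 1]) auto

text \<open>As lengths are constant on the domain, an index belongs to \<open>f\<close> or to
  \<open>g\<close> uniformly in \<open>v\<close>.\<close>

lemma elem_diff_vec_append: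
  assumes "elem_diff_vec p f" "elem_diff_vec p g" shows "elem_diff_vec p (\<lambda>v. f v @ g v)"
proof -
  from assms(1) obtain k where k: "\<And>v. length v = p \<Longrightarrow> length (f v) = k"
      "\<And>i. i < k \<Longrightarrow> elem_diff p (\<lambda>v. f v ! i)"
    by (auto simp: elem_diff_vec_def natvec_def)
  from assms(2) obtain l where l: "\<And>v. length v = p \<Longrightarrow> length (g v) = l"
      "\<And>i. i < l \<Longrightarrow> elem_diff p (\<lambda>v. g v ! i)"
    by (auto simp: elem_diff_vec_def natvec_def)
  have "elem_diff p (\<lambda>v. (f v @ g v) ! i)" if "i < k + l" for i
  proof (cases "i < k")
    case True
    from k(2)[OF this] show ?thesis
      by (rule elem_diff_cong[THEN iffD1, rotated]) (auto simp: nth_append k True)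
  next
    case False
    with that have "i - k < l" by simp
    from l(2)[OF this] show ?thesis
      by (rule elem_diff_cong[THEN iffD1, rotated]) (auto simp: nth_append k False)
  qed
  then show ?thesis unfolding elem_diff_vec_def
    by (intro exI[of _ "k + l"]) (auto simp: k l natvec_def)
qed

lemma elem_diff_vec_concat:
  "(\<And>g. g \<in> set gs \<Longrightarrow> elem_diff_vec p g) \<Longrightarrow> elem_diff_vec p (\<lambda>v. concat (map (\<lambda>g. g v) gs))"
proof (induction gs)
  case Nil
  show ?case by (auto simp: elem_diff_vec_def)
qed (simp add: elem_diff_vec_append)

text \<open>
  Quantifying over the inner functions treats outer functions on \<open>\<nat>\<^sup>p\<close> and on \<open>\<int>\<^sup>p\<close> alike and makes the
  property closed under composition.
\<close>

definition preserves_elem_diff_vec :: "int list set \<Rightarrow> (int list \<Rightarrow> int list) \<Rightarrow> bool" where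
  "preserves_elem_diff_vec D f \<longleftrightarrow>
    (\<forall>p a. elem_diff_vec p a \<longrightarrow> (\<forall>v\<in>natvec p. a v \<in> D) \<longrightarrow> elem_diff_vec p (\<lambda>v. f (a v)))"

text \<open>One direction tests the property on the inclusion \<open>map int\<close>. For the other,
  an inner function into \<open>Nvec p\<close> has nonnegative components, which are elementary as
  natural functions and can be substituted.\<close>

lemma preserves_elem_diff_vec_Nvec_iff:
  "preserves_elem_diff_vec (Nvec p) f \<longleftrightarrow> elem_diff_vec p (\<lambda>v. f (map int v))"
proof
  assume "preserves_elem_diff_vec (Nvec p) f"
  moreover have "elem_diff_vec p (map int)"
  proof -
    have "elem_diff p (\<lambda>v. map int v ! i)" if "i < p" for i
      using elem_diff_int[OF elem_proj[OF that]]
      by (rule elem_diff_cong[THEN iffD1, rotated]) (use that in auto)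
    then show ?thesis unfolding elem_diff_vec_def by (intro exI[of _ p]) (auto simp: natvec_def)
  qed
  ultimately show "elem_diff_vec p (\<lambda>v. f (map int v))"
    unfolding preserves_elem_diff_vec_def by (auto simp: Nvec_def natvec_def)
next
  assume f: "elem_diff_vec p (\<lambda>v. f (map int v))"
  then obtain k where k: "\<And>v. length v = p \<Longrightarrow> length (f (map int v)) = k"
      "\<And>i. i < k \<Longrightarrow> elem_diff p (\<lambda>v. f (map int v) ! i)"
    by (auto simp: elem_diff_vec_def natvec_def)
  show "preserves_elem_diff_vec (Nvec p) f"
    unfolding preserves_elem_diff_vec_def
  proof (intro allI impI)
    fix q a assume a: "elem_diff_vec q a" "\<forall>v\<in>natvec q. a v \<in> Nvec p"
    then have a_N: "length (a v) = p" "\<And>i. i < p \<Longrightarrow> 0 \<le> a v ! i" if "length v = q" for v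
      using that by (auto simp: Nvec_def natvec_def)
    define gs where "gs = map (\<lambda>i v. nat (a v ! i)) [0..<p]"
    have gs: "length gs = p" "\<And>g. g \<in> set gs \<Longrightarrow> elem q g"
      using a a_N by (auto simp: gs_def intro!: elem_diff_nonneg elem_diff_vec_nth)
    have a_eq: "map int (map (\<lambda>g. g v) gs) = a v" if "length v = q" for v
      using a_N[OF that] by (intro nth_equalityI) (auto simp: gs_def)
    have "elem_diff_vec q (\<lambda>v. f (map int (map (\<lambda>g. g v) gs)))"
      unfolding elem_diff_vec_def
    proof (intro exI[of _ k] conjI ballI allI impI)
      fix i assume "i < k"
      then show "elem_diff q (\<lambda>v. f (map int (map (\<lambda>g. g v) gs)) ! i)"
        using elem_diff_comp[of gs "\<lambda>v. f (map int v) ! i" q] k(2) gs by simp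
    qed (simp only: k gs length_map)
    then show "elem_diff_vec q (\<lambda>v. f (a v))"
      by (rule elem_diff_vec_cong[THEN iffD1, rotated]) (simp only: a_eq)
  qed
qed

lemma map_int_in_Nvec: "map int v \<in> Nvec p \<longleftrightarrow> length v = p"
  by (auto simp: Nvec_def)

lemma elem_diff_of_scalar:
  assumes "preserves_elem_diff_vec (Nvec p) (\<lambda>v\<in>Nvec p. [f v])"
  shows "elem_diff p (\<lambda>v. f (map int v))"
proof -
  have "elem_diff p (\<lambda>v. (\<lambda>v\<in>Nvec p. [f v]) (map int v) ! 0)"
    using assms
      by (intro elem_diff_vec_nth) (auto simp: preserves_elem_diff_vec_Nvec_iff map_int_in_Nvec)
  then show ?thesis
    by (rule elem_diff_cong[THEN iffD1, rotated]) (simp add: map_int_in_Nvec)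
qed

lemma preserves_elem_diff_vec_LI:
  assumes G: "\<And>i. i < k \<Longrightarrow> elem_diff p (\<lambda>v. G i (map int v))"
    and A: "\<And>i j. i < k \<Longrightarrow> j < k \<Longrightarrow> elem_diff (Suc p) (\<lambda>v. A i j (map int v))"
    and B: "\<And>i. i < k \<Longrightarrow> elem_diff (Suc p) (\<lambda>v. B i (map int v))"
    and f: "is_LI k p G A B f"
  shows "preserves_elem_diff_vec (Nvec (Suc p)) f"
proof -
  have "elem_diff (Suc p) (\<lambda>w. f (int (hd w) # map int (tl w)) ! i)" if "i < k" for i
  proof (rule elem_diff_linear_system[where h = "\<lambda>x i y. f (int x # map int y) ! i", OF G _ B _ _ that])
    fix i x and y :: "nat list" assume i: "i < k" and y: "length y = p"
    show "f (int 0 # map int y) ! i = G i (map int y)"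
      using f i y by (simp add: is_LI_def map_int_in_Nvec)
    have "delta (\<lambda>t. f (t # map int y) ! i) (int x) =
        (\<Sum>j<k. A i j (int x # map int y) * f (int x # map int y) ! j) + B i (int x # map int y)"
      using f i y by (simp add: is_LI_def map_int_in_Nvec)
    then have "f (int (Suc x) # map int y) ! i = f (int x # map int y) ! i +
        (\<Sum>j<k. A i j (int x # map int y) * f (int x # map int y) ! j) + B i (int x # map int y)"
      by (simp add: delta_def add.commute)
    \<comment> \<open>The old value is written as a row of the identity matrix applied to the
      vector, which turns the difference equation into a recurrence with matrix
      \<open>A + I\<close>.\<close>
    also have "f (int x # map int y) ! i = (\<Sum>j<k. of_bool (i = j) * f (int x # map int y) ! j)"
      using i by (simp add: of_bool_def if_distrib[of "\<lambda>x. x * _"] cong: if_cong)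
    finally show "f (int (Suc x) # map int y) ! i =
        (\<Sum>j<k. (A i j (map int (x # y)) + of_bool (i = j)) * f (int x # map int y) ! j)
          + B i (map int (x # y))"
      by (simp add: distrib_right sum.distrib)
  next
    fix i j assume "i < k" "j < k"
    then show "elem_diff (Suc p) (\<lambda>v. A i j (map int v) + of_bool (i = j))"
      using elem_diff_int[OF elem_const[of "Suc p" "of_bool (i = j)"]]
        by (intro elem_diff_add A) simp_all
  qed
  then have "elem_diff (Suc p) (\<lambda>w. f (map int w) ! i)" if "i < k" for i
    by (rule elem_diff_cong[THEN iffD1, rotated]) (use that in \<open>auto simp: length_Suc_conv\<close>)
  moreover have "length (f (map int v)) = k" if "length v = Suc p" for v
    using f that map_int_in_Nvec[of v "Suc p"] by (auto simp: is_LI_def Zvec_def PiE_iff)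
  ultimately show ?thesis
    unfolding preserves_elem_diff_vec_Nvec_iff elem_diff_vec_def
      by (intro exI[of _ k]) (auto simp: natvec_def)
qed

text \<open>Valid for every set \<open>K\<close> of dimensions, so it serves the vectorial and the
  scalar class at once.\<close>

lemma ODE_class_preserves_elem_diff_vec: "(D, f) \<in> ODE_class K \<Longrightarrow> preserves_elem_diff_vec D f"
proof (induction D f rule: ODE_class.induct)
  case (zero p)
  show ?case unfolding preserves_elem_diff_vec_Nvec_iff
    using elem_diff_vec_single[OF elem_diff_int[OF elem_const[of p 0]]]
    by (rule elem_diff_vec_cong[THEN iffD1, rotated]) (auto simp: map_int_in_Nvec)
next
  case (projN i p)
  show ?case unfolding preserves_elem_diff_vec_Nvec_iff
    using elem_diff_vec_single[OF elem_diff_int[OF elem_proj[OF projN]]]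
    by (rule elem_diff_vec_cong[THEN iffD1, rotated]) (use projN in \<open>auto simp: map_int_in_Nvec\<close>)
next
  case (projZ i p)
  show ?case unfolding preserves_elem_diff_vec_def
  proof (intro allI impI)
    fix q a assume a: "elem_diff_vec q a" "\<forall>v\<in>natvec q. a v \<in> Zvec p"
    then have "elem_diff_vec q (\<lambda>v. [a v ! i])"
      using projZ
        by (intro elem_diff_vec_single elem_diff_vec_nth) (auto simp: Zvec_def natvec_def)
    then show "elem_diff_vec q (\<lambda>v. (\<lambda>v\<in>Zvec p. [v ! i]) (a v))"
      by (rule elem_diff_vec_cong[THEN iffD1, rotated]) (use a in \<open>auto simp: natvec_def\<close>)
  qed
next
  case succ
  show ?case unfolding preserves_elem_diff_vec_Nvec_iff
    using elem_diff_vec_single[OF elem_diff_int[OF elem_Suc[OF elem_proj[of 0 1]]]]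
    by (rule elem_diff_vec_cong[THEN iffD1, rotated]) (auto simp: map_int_in_Nvec)
next
  case add
  show ?case unfolding preserves_elem_diff_vec_def
  proof (intro allI impI)
    fix q a assume a: "elem_diff_vec q a" "\<forall>v\<in>natvec q. a v \<in> Zvec 2"
    then have "elem_diff_vec q (\<lambda>v. [a v ! 0 + a v ! 1])"
      by (intro elem_diff_vec_single elem_diff_vec_nth elem_diff_add)
        (auto simp: Zvec_def natvec_def)
    then show "elem_diff_vec q (\<lambda>v. (\<lambda>v\<in>Zvec 2. [v ! 0 + v ! 1]) (a v))"
      by (rule elem_diff_vec_cong[THEN iffD1, rotated]) (use a in \<open>auto simp: natvec_def\<close>)
  qed
next
  case sub
  show ?case unfolding preserves_elem_diff_vec_def
  proof (intro allI impI)
    fix q a assume a: "elem_diff_vec q a" "\<forall>v\<in>natvec q. a v \<in> Zvec 2"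
    then have "elem_diff_vec q (\<lambda>v. [a v ! 0 - a v ! 1])"
      by (intro elem_diff_vec_single elem_diff_vec_nth elem_diff_diff)
        (auto simp: Zvec_def natvec_def)
    then show "elem_diff_vec q (\<lambda>v. (\<lambda>v\<in>Zvec 2. [v ! 0 - v ! 1]) (a v))"
      by (rule elem_diff_vec_cong[THEN iffD1, rotated]) (use a in \<open>auto simp: natvec_def\<close>)
  qed
next
  case (comp E h D gs)
  show ?case unfolding preserves_elem_diff_vec_def
  proof (intro allI impI)
    fix q a assume a: "elem_diff_vec q a" "\<forall>v\<in>natvec q. a v \<in> D"
    \<comment> \<open>Each inner function after \<open>a\<close> is covered by its hypothesis; their
      concatenation is then the inner function for \<open>h\<close>.\<close>
    have "elem_diff_vec q (\<lambda>v. concat (map (\<lambda>g. g v) (map (\<lambda>g v. g (a v)) gs)))"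
      using comp.IH(2) a by (intro elem_diff_vec_concat) (auto simp: preserves_elem_diff_vec_def)
    then have "elem_diff_vec q (\<lambda>v. h (concat (map (\<lambda>g. g (a v)) gs)))"
      using comp.IH(1) comp.hyps a by (auto simp: preserves_elem_diff_vec_def comp_def)
    then show "elem_diff_vec q (\<lambda>v. (\<lambda>v\<in>D. h (concat (map (\<lambda>g. g v) gs))) (a v))"
      by (rule elem_diff_vec_cong[THEN iffD1, rotated]) (use a in \<open>auto simp: natvec_def\<close>)
  qed
next
  case (LI k p G A B f)
  show ?case
    by (rule preserves_elem_diff_vec_LI[OF _ _ _ \<open>is_LI k p G A B f\<close>];
      rule elem_diff_of_scalar; rule LI.IH; assumption)
qed

lemma nat_functions_ODE_class_subset: "nat_functions (ODE_class K) \<subseteq> elementary"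
proof (clarsimp simp: nat_functions_def)
  fix p f assume ext: "f \<in> extensional (natvec p)"
    and "(Nvec p, \<lambda>v\<in>Nvec p. [int (f (map nat v))]) \<in> ODE_class K"
  then have "elem_diff p (\<lambda>v. int (f (map nat (map int v))))"
    by (intro elem_diff_of_scalar ODE_class_preserves_elem_diff_vec)
  then have "elem p (\<lambda>v. nat (int (f v)))"
    by (intro elem_diff_nonneg) (simp_all add: comp_def)
  then show "(p, f) \<in> elementary"
    using ext by (simp add: elem_def extensional_restrict)
qed

section \<open>Elementary functions by scalar linear equations\<close>

text \<open>Working with dimension 1 alone gives the stronger inclusion; the vectorial one follows
  by monotonicity in \<open>K\<close>.\<close>

definition scalar_ode :: "nat \<Rightarrow> (int list \<Rightarrow> int) \<Rightarrow> bool" where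
  "scalar_ode p f \<longleftrightarrow> (Nvec p, \<lambda>v\<in>Nvec p. [f v]) \<in> ODE_class {1}"

lemma scalar_ode_cong: "(\<And>v. v \<in> Nvec p \<Longrightarrow> f v = g v) \<Longrightarrow> scalar_ode p f \<longleftrightarrow> scalar_ode p g"
proof -
  assume "\<And>v. v \<in> Nvec p \<Longrightarrow> f v = g v"
  then have "(\<lambda>v\<in>Nvec p. [f v]) = (\<lambda>v\<in>Nvec p. [g v])" by auto
  then show ?thesis by (simp add: scalar_ode_def)
qed

text \<open>The domain \<open>E\<close> is left open so that addition and subtraction, defined on
  \<open>Zvec 2\<close>, accept negative inner values.\<close>

lemma scalar_ode_comp_gen:
  assumes "(E, \<lambda>v\<in>E. [h v]) \<in> ODE_class {1}" "\<And>g. g \<in> set gs \<Longrightarrow> scalar_ode p g"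
    and E: "\<And>v. v \<in> Nvec p \<Longrightarrow> map (\<lambda>g. g v) gs \<in> E"
  shows "scalar_ode p (\<lambda>v. h (map (\<lambda>g. g v) gs))"
proof -
  let ?gs = "map (\<lambda>g. \<lambda>v\<in>Nvec p. [g v]) gs"
  have concat: "concat (map (\<lambda>g. g v) ?gs) = map (\<lambda>g. g v) gs" if "v \<in> Nvec p" for v
    using that by (induction gs) auto
  have "(Nvec p, \<lambda>v\<in>Nvec p. (\<lambda>v\<in>E. [h v]) (concat (map (\<lambda>g. g v) ?gs))) \<in> ODE_class {1}"
    by (rule ODE_class.comp[of E "\<lambda>v\<in>E. [h v]"])
      (use assms concat in \<open>auto simp: scalar_ode_def simp del: map_map\<close>)
  also have "(\<lambda>v\<in>Nvec p. (\<lambda>v\<in>E. [h v]) (concat (map (\<lambda>g. g v) ?gs))) =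
      (\<lambda>v\<in>Nvec p. [h (map (\<lambda>g. g v) gs)])"
    by (intro restrict_ext) (simp only: concat E restrict_apply if_True)
  finally show ?thesis unfolding scalar_ode_def .
qed

lemma scalar_ode_comp:
  assumes "scalar_ode (length gs) h" "\<And>g. g \<in> set gs \<Longrightarrow> scalar_ode p g"
    and "\<And>v g. v \<in> Nvec p \<Longrightarrow> g \<in> set gs \<Longrightarrow> 0 \<le> g v"
  shows "scalar_ode p (\<lambda>v. h (map (\<lambda>g. g v) gs))"
  by (rule scalar_ode_comp_gen[where E = "Nvec (length gs)"])
    (use assms in \<open>auto simp: scalar_ode_def Nvec_def\<close>)

lemma scalar_ode_add: "scalar_ode p f \<Longrightarrow> scalar_ode p g \<Longrightarrow> scalar_ode p (\<lambda>v. f v + g v)"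
  using scalar_ode_comp_gen[OF ODE_class.add, of "[f, g]" p] by (auto simp: Zvec_def)

lemma scalar_ode_diff: "scalar_ode p f \<Longrightarrow> scalar_ode p g \<Longrightarrow> scalar_ode p (\<lambda>v. f v - g v)"
  using scalar_ode_comp_gen[OF ODE_class.sub, of "[f, g]" p] by (auto simp: Zvec_def)

lemma scalar_ode_zero: "scalar_ode p (\<lambda>v. 0)"
  unfolding scalar_ode_def by (rule ODE_class.zero)

lemma scalar_ode_one: "scalar_ode p (\<lambda>v. 1)"
  using scalar_ode_comp_gen[OF ODE_class.succ, of "[\<lambda>_. 0]" p]
    by (simp add: Nvec_def scalar_ode_zero)

lemma scalar_ode_proj: "i < p \<Longrightarrow> scalar_ode p (\<lambda>v. v ! i)"
  unfolding scalar_ode_def by (rule ODE_class.projN)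

text \<open>Allows a closed form \<open>f\<close> to be supplied and checked against the
  equation.\<close>

lemma scalar_ode_scalar_LI:
  assumes "scalar_ode p G" "\<And>y. y \<in> Nvec p \<Longrightarrow> 0 \<le> G y" "scalar_ode (Suc p) A" "scalar_ode (Suc p) B"
    and f0: "\<And>y. y \<in> Nvec p \<Longrightarrow> f (0 # y) = G y"
    and fS: "\<And>x y. y \<in> Nvec p \<Longrightarrow> 0 \<le> x \<Longrightarrow>
      f ((x + 1) # y) = f (x # y) + A (x # y) * f (x # y) + B (x # y)"
  shows "scalar_ode (Suc p) f"
  unfolding scalar_ode_def
proof (rule ODE_class.LI[where k = 1 and G = "\<lambda>_. G" and A = "\<lambda>_ _. A" and B = "\<lambda>_. B"])
  show "is_LI 1 p (\<lambda>_. G) (\<lambda>_ _. A) (\<lambda>_. B) (\<lambda>v\<in>Nvec (Suc p). [f v])"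
    unfolding is_LI_def
  proof (intro conjI ballI allI impI)
    show "(\<lambda>v\<in>Nvec (Suc p). [f v]) \<in> Nvec (Suc p) \<rightarrow>\<^sub>E Zvec 1"
      by (auto simp: Zvec_def)
  qed (use f0 fS in \<open>auto simp: delta_def Nvec_def\<close>)
qed (use assms in \<open>auto simp: scalar_ode_def\<close>)

lemma Nvec_SucE:
  assumes "w \<in> Nvec (Suc p)"
  obtains x y where "w = int x # y" "y \<in> Nvec p"
proof -
  from assms obtain z y where "w = z # y" "0 \<le> z" "y \<in> Nvec p"
    by (cases w) (auto simp: Nvec_def)
  then show thesis using that[of "nat z" y] by simp
qed

lemma Cons_in_Nvec: "x # y \<in> Nvec (Suc p) \<longleftrightarrow> 0 \<le> x \<and> y \<in> Nvec p"
  by (auto simp: Nvec_def)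

lemma scalar_ode_hd: "scalar_ode (Suc p) hd"
proof -
  have "scalar_ode (Suc p) (\<lambda>v. v ! 0)" by (rule scalar_ode_proj) simp
  then show ?thesis by (rule scalar_ode_cong[THEN iffD1, rotated]) (auto elim!: Nvec_SucE)
qed

lemma scalar_ode_tl:
  assumes "scalar_ode p f" shows "scalar_ode (Suc p) (\<lambda>w. f (tl w))"
proof -
  have "scalar_ode (Suc p) (\<lambda>w. f (map (\<lambda>g. g w) (map (\<lambda>i w. w ! Suc i) [0..<p])))"
    by (rule scalar_ode_comp) (use assms in \<open>auto simp: Nvec_def intro: scalar_ode_proj\<close>)
  moreover have "map (\<lambda>g. g w) (map (\<lambda>i w. w ! Suc i) [0..<p]) = tl w"
    if "w \<in> Nvec (Suc p)" for w :: "int list"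
    using that by (intro nth_equalityI) (auto simp: nth_tl Nvec_def)
  ultimately show ?thesis by (subst scalar_ode_cong) auto
qed

lemma scalar_ode_subst:
  assumes "scalar_ode (Suc p) g" "scalar_ode p b" "\<And>v. v \<in> Nvec p \<Longrightarrow> 0 \<le> b v"
  shows "scalar_ode p (\<lambda>v. g (b v # v))"
proof -
  have "scalar_ode p (\<lambda>v. g (map (\<lambda>g. g v) (b # map (\<lambda>i v. v ! i) [0..<p])))"
    by (rule scalar_ode_comp) (use assms in \<open>auto simp: Nvec_def intro: scalar_ode_proj\<close>)
  moreover have "map (\<lambda>g. g w) (map (\<lambda>i w. w ! i) [0..<p]) = w"
    if "w \<in> Nvec p" for w :: "int list"
    using that by (intro nth_equalityI) (auto simp: Nvec_def)
  ultimately show ?thesis by (subst scalar_ode_cong) auto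
qed

text \<open>The step from \<open>x\<close> to \<open>x + 1\<close> in a bounded sum or product
  involves the term at \<open>x + 1\<close>, while coefficients are evaluated at
  \<open>x\<close>.\<close>

lemma scalar_ode_shift:
  assumes "scalar_ode (Suc p) g" shows "scalar_ode (Suc p) (\<lambda>w. g ((hd w + 1) # tl w))"
proof -
  have hd: "0 \<le> hd w + 1" if "w \<in> Nvec (Suc p)" for w
    using that by (auto elim!: Nvec_SucE)
  have "scalar_ode (Suc p) (\<lambda>w. g (map (\<lambda>g. g w) ((\<lambda>w. hd w + 1) # map (\<lambda>i w. w ! Suc i) [0..<p])))"
    by (rule scalar_ode_comp)
      (use assms hd in \<open>auto simp: Nvec_def intro!: scalar_ode_proj scalar_ode_add scalar_ode_hd scalar_ode_one\<close>)
  moreover have "map (\<lambda>g. g w) (map (\<lambda>i w. w ! Suc i) [0..<p]) = tl w"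
    if "w \<in> Nvec (Suc p)" for w :: "int list"
    using that by (intro nth_equalityI) (auto simp: nth_tl Nvec_def)
  ultimately show ?thesis by (subst scalar_ode_cong) auto
qed

section \<open>Arithmetic and comparison by scalar equations\<close>

lemma scalar_ode_sum:
  assumes g: "scalar_ode (Suc p) g" and nonneg: "\<And>w. w \<in> Nvec (Suc p) \<Longrightarrow> 0 \<le> g w"
  shows "scalar_ode (Suc p) (\<lambda>w. \<Sum>z\<le>nat (hd w). g (int z # tl w))"
proof (rule scalar_ode_scalar_LI)
  \<comment> \<open>The range \<open>z \<le> 0\<close> contains one term, so the initial value is
    \<open>g (0 # v)\<close>; \<open>nonneg\<close> makes it a natural number.\<close>
  show "scalar_ode p (\<lambda>v. g (0 # v))" by (rule scalar_ode_subst[OF g scalar_ode_zero]) simp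
  show "scalar_ode (Suc p) (\<lambda>w. 0)" by (rule scalar_ode_zero)
  show "scalar_ode (Suc p) (\<lambda>w. g ((hd w + 1) # tl w))" by (rule scalar_ode_shift[OF g])
next
  fix x :: int and y :: "int list" assume "0 \<le> x"
  then have "nat (x + 1) = Suc (nat x)" by simp
  then show "(\<Sum>z\<le>nat (hd ((x + 1) # y)). g (int z # tl ((x + 1) # y))) =
      (\<Sum>z\<le>nat (hd (x # y)). g (int z # tl (x # y))) +
      0 * (\<Sum>z\<le>nat (hd (x # y)). g (int z # tl (x # y))) + g ((hd (x # y) + 1) # tl (x # y))"
    using \<open>0 \<le> x\<close> by (simp add: add.commute)
qed (auto intro: nonneg simp: Cons_in_Nvec)

lemma scalar_ode_prod:
  assumes g: "scalar_ode (Suc p) g" and nonneg: "\<And>w. w \<in> Nvec (Suc p) \<Longrightarrow> 0 \<le> g w"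
  shows "scalar_ode (Suc p) (\<lambda>w. \<Prod>z\<le>nat (hd w). g (int z # tl w))"
proof (rule scalar_ode_scalar_LI)
  show "scalar_ode p (\<lambda>v. g (0 # v))" by (rule scalar_ode_subst[OF g scalar_ode_zero]) simp
  show "scalar_ode (Suc p) (\<lambda>w. g ((hd w + 1) # tl w) - 1)"
    by (intro scalar_ode_diff scalar_ode_one scalar_ode_shift[OF g])
  show "scalar_ode (Suc p) (\<lambda>w. 0)" by (rule scalar_ode_zero)
next
  fix x :: int and y :: "int list" assume "0 \<le> x"
  then have "nat (x + 1) = Suc (nat x)" by simp
  then show "(\<Prod>z\<le>nat (hd ((x + 1) # y)). g (int z # tl ((x + 1) # y))) =
      (\<Prod>z\<le>nat (hd (x # y)). g (int z # tl (x # y))) +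
      (g ((hd (x # y) + 1) # tl (x # y)) - 1) * (\<Prod>z\<le>nat (hd (x # y)). g (int z # tl (x # y))) + 0"
    using \<open>0 \<le> x\<close> by (simp add: algebra_simps)
qed (auto intro: nonneg simp: Cons_in_Nvec)

text \<open>The function \<open>x * g y\<close> starts at 0 and has constant derivative
  \<open>g y\<close>. Substituting \<open>f\<close> for \<open>x\<close> requires \<open>f\<close>
  to be nonnegative, whereas \<open>g\<close> may have any sign.\<close>

lemma scalar_ode_mult:
  assumes "scalar_ode p f" "scalar_ode p g" "\<And>v. v \<in> Nvec p \<Longrightarrow> 0 \<le> f v"
  shows "scalar_ode p (\<lambda>v. f v * g v)"
proof -
  have "scalar_ode (Suc p) (\<lambda>w. hd w * g (tl w))"
    by (rule scalar_ode_scalar_LI[of _ "\<lambda>_. 0" "\<lambda>_. 0" "\<lambda>w. g (tl w)"])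
      (auto intro: scalar_ode_zero scalar_ode_tl assms simp: algebra_simps)
  from scalar_ode_subst[OF this assms(1,3)] show ?thesis by simp
qed

lemma scalar_ode_sgn:
  assumes "scalar_ode p f" "\<And>v. v \<in> Nvec p \<Longrightarrow> 0 \<le> f v"
  shows "scalar_ode p (\<lambda>v. sgn (f v))"
proof -
  have "scalar_ode (Suc p) (\<lambda>w. sgn (hd w))"
    by (rule scalar_ode_scalar_LI[of _ "\<lambda>_. 0" "\<lambda>_. 0 - 1" "\<lambda>w. 1"])
      (auto intro: scalar_ode_zero scalar_ode_one scalar_ode_diff[OF scalar_ode_zero scalar_ode_one, simplified])
  from scalar_ode_subst[OF this assms] show ?thesis by simp
qed

text \<open>Only the factor at \<open>z = m\<close> vanishes, and it occurs exactly when
  \<open>m \<le> n\<close>. Squaring keeps the other factors equal to 1.\<close>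

lemma prod_sgn_square:
  "(\<Prod>z\<le>n. sgn ((int m - int z) * (int m - int z))) = of_bool (n < m)"
proof -
  have "(\<Prod>z\<le>n. sgn ((int m - int z) * (int m - int z))) = (\<Prod>z\<le>n. of_bool (z \<noteq> m))"
    by (intro prod.cong) (auto simp: sgn_mult_self_eq sgn_mult)
  also have "\<dots> = of_bool (n < m)"
    by (cases "n < m") (auto intro!: prod.neutral)
  finally show ?thesis .
qed

lemma scalar_ode_less:
  assumes f: "scalar_ode p f" "\<And>v. v \<in> Nvec p \<Longrightarrow> 0 \<le> f v"
    and g: "scalar_ode p g" "\<And>v. v \<in> Nvec p \<Longrightarrow> 0 \<le> g v"
  shows "scalar_ode p (\<lambda>v. of_bool (g v < f v))"
proof -
  have f': "scalar_ode (Suc p) (\<lambda>w. f (tl w))" by (rule scalar_ode_tl[OF f(1)])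
  have tl: "0 \<le> f (tl w)" "0 \<le> hd w" if "w \<in> Nvec (Suc p)" for w
    using that f(2) by (auto elim!: Nvec_SucE)
  txt \<open>\<open>scalar_ode_mult\<close> needs a nonnegative factor, hence the expanded square.\<close>
  have "scalar_ode (Suc p) (\<lambda>w. f (tl w) * f (tl w) + hd w * hd w - (hd w * f (tl w) + hd w * f (tl w)))"
    by (intro scalar_ode_diff scalar_ode_add scalar_ode_mult scalar_ode_hd f' tl)
  then have "scalar_ode (Suc p) (\<lambda>w. (f (tl w) - hd w) * (f (tl w) - hd w))"
    by (simp add: algebra_simps)
  then have "scalar_ode (Suc p) (\<lambda>w. \<Prod>z\<le>nat (hd w). sgn ((f (tl w) - int z) * (f (tl w) - int z)))"
    using scalar_ode_prod[OF scalar_ode_sgn, of p "\<lambda>w. (f (tl w) - hd w) * (f (tl w) - hd w)"]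
    by (simp add: sgn_mult sgn_mult_self_eq)
  from scalar_ode_subst[OF this g]
  have "scalar_ode p (\<lambda>v. \<Prod>z\<le>nat (g v). sgn ((f v - int z) * (f v - int z)))" by simp
  moreover have "(\<Prod>z\<le>nat (g v). sgn ((f v - int z) * (f v - int z))) = of_bool (g v < f v)"
    if "v \<in> Nvec p" for v
    using prod_sgn_square[of "nat (f v)" "nat (g v)"] f(2)[OF that] g(2)[OF that]
    by (simp add: nat_less_eq_zless)
  ultimately show ?thesis by (subst scalar_ode_cong) auto
qed

text \<open>The indicator is the nonnegative factor required for multiplication; the difference,
  possibly negative, is the other one.\<close>

lemma scalar_ode_monus:
  assumes f: "scalar_ode p f" "\<And>v. v \<in> Nvec p \<Longrightarrow> 0 \<le> f v"
    and g: "scalar_ode p g" "\<And>v. v \<in> Nvec p \<Longrightarrow> 0 \<le> g v"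
  shows "scalar_ode p (\<lambda>v. max 0 (f v - g v))"
proof -
  have "scalar_ode p (\<lambda>v. of_bool (g v < f v) * (f v - g v))"
    by (intro scalar_ode_mult scalar_ode_less scalar_ode_diff f g) auto
  then show ?thesis by (rule scalar_ode_cong[THEN iffD1, rotated]) auto
qed

section \<open>Transfer of elementary functions to integer tuples and the equality of the
  classes\<close>

lemma map_nat_in_natvec: "v \<in> Nvec p \<Longrightarrow> map nat v \<in> natvec p"
  by (auto simp: Nvec_def natvec_def)

lemma elementary_imp_scalar_ode: "(p, f) \<in> elementary \<Longrightarrow> scalar_ode p (\<lambda>v. int (f (map nat v)))"
proof (induction p f rule: elementary.induct)
  case (zero p)
  show ?case using scalar_ode_zero[of p]
    by (rule scalar_ode_cong[THEN iffD1, rotated]) (auto simp: map_nat_in_natvec)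
next
  case (proj i p)
  show ?case using scalar_ode_proj[OF proj]
    by (rule scalar_ode_cong[THEN iffD1, rotated])
      (use proj in \<open>auto simp: map_nat_in_natvec Nvec_def natvec_def\<close>)
next
  case succ
  show ?case using scalar_ode_add[OF scalar_ode_proj[of 0 1] scalar_ode_one]
    by (rule scalar_ode_cong[THEN iffD1, rotated]) (auto simp: Nvec_def natvec_def)
next
  case add
  show ?case using scalar_ode_add[OF scalar_ode_proj[of 0 2] scalar_ode_proj[of 1 2]]
    by (rule scalar_ode_cong[THEN iffD1, rotated]) (auto simp: Nvec_def natvec_def)
next
  case monus
  have nonneg: "0 \<le> v ! 0" "0 \<le> v ! 1" if "v \<in> Nvec 2" for v
    using that by (auto simp: Nvec_def)
  have "scalar_ode 2 (\<lambda>v. max 0 (v ! 0 - v ! 1))"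
    by (intro scalar_ode_monus scalar_ode_proj nonneg) auto
  then show ?case
  proof (rule scalar_ode_cong[THEN iffD1, rotated])
    fix v assume "v \<in> Nvec 2"
    with nonneg[OF this] show "max 0 (v ! 0 - v ! 1) =
        int ((\<lambda>v\<in>natvec 2. v ! 0 - v ! 1) (map nat v))"
      by (auto simp: map_nat_in_natvec Nvec_def nat_diff_distrib' max_def simp flip: nat_diff_distrib')
  qed
next
  case (comp gs h p)
  \<comment> \<open>The inner values are images under \<open>int\<close>, hence nonnegative, and
    \<open>nat\<close> recovers them exactly.\<close>
  have "scalar_ode p (\<lambda>v. int (h (map nat (map (\<lambda>g. g v) (map (\<lambda>g v. int (g (map nat v))) gs)))))"
    using comp.IH by (intro scalar_ode_comp[where h = "\<lambda>v. int (h (map nat v))"]) auto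
  then show ?case
    by (rule scalar_ode_cong[THEN iffD1, rotated]) (simp add: map_nat_in_natvec comp_def)
next
  case (bsum p g)
  have "scalar_ode (Suc p) (\<lambda>w. \<Sum>z\<le>nat (hd w). int (g (map nat (int z # tl w))))"
    by (rule scalar_ode_sum[OF bsum.IH]) simp
  then show ?case
    by (rule scalar_ode_cong[THEN iffD1, rotated]) (auto simp: map_nat_in_natvec elim!: Nvec_SucE)
next
  case (bprod p g)
  have "scalar_ode (Suc p) (\<lambda>w. \<Prod>z\<le>nat (hd w). int (g (map nat (int z # tl w))))"
    by (rule scalar_ode_prod[OF bprod.IH]) simp
  then show ?case
    by (rule scalar_ode_cong[THEN iffD1, rotated]) (auto simp: map_nat_in_natvec elim!: Nvec_SucE)
qed

lemma elementary_extensional: "(p, f) \<in> elementary \<Longrightarrow> f \<in> extensional (natvec p)"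
  by (induction p f rule: elementary.induct) (rule restrict_extensional)+

lemma elementary_subset: "elementary \<subseteq> nat_functions (ODE_class {1})"
  using elementary_imp_scalar_ode elementary_extensional
    by (auto simp: nat_functions_def scalar_ode_def)

text \<open>The set \<open>K\<close> enters only through the side condition \<open>k \<in> K\<close>
  of \<open>LI\<close>, so derivations carry over rule by rule.\<close>

lemma ODE_class_mono:
  assumes "K \<subseteq> L" shows "ODE_class K \<subseteq> ODE_class L"
proof (rule subrelI)
  fix D f assume "(D, f) \<in> ODE_class K"
  then show "(D, f) \<in> ODE_class L"
  proof (induction D f rule: ODE_class.induct)
    case (comp E h D gs)
    then show ?case by (intro ODE_class.comp)
  next
    case (LI k p G A B f)
    show ?case
      by (rule ODE_class.LI[OF subsetD[OF assms \<open>k \<in> K\<close>] _ _ _ _ \<open>is_LI k p G A B f\<close>];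
          rule LI.IH LI.hyps; assumption)
  qed (rule ODE_class.zero ODE_class.projN ODE_class.projZ
    ODE_class.succ ODE_class.add ODE_class.sub; assumption?)+
qed

theorem mainTheorem2:
  "elementary = nat_functions vectorial_class \<and> elementary = nat_functions scalar_class"
proof -
  \<comment> \<open>This closes the cycle of inclusions from elementary to scalar to vectorial and
    back to elementary.\<close>
  have "nat_functions (ODE_class {1}) \<subseteq> nat_functions (ODE_class {1..})"
    using ODE_class_mono[of "{1}" "{1..}"] by (auto simp: nat_functions_def)
  then show ?thesis
    unfolding vectorial_class_def scalar_class_def
    using elementary_subset nat_functions_ODE_class_subset by blast
qed

end
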